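(* Let $k\geq 2$ be an integer, and let $\Delta$ be a simplicial complex of dimension $\geq k-1$ with $n$ vertices. Then $$ m_k(\Delta)\geq \frac{k^2}{(k+1)\binom{n}{k-1}}f_{k-1}(\Delta)^2-\frac{n(k-1)-k(k-2)}{k+1}f_{k-1}(\Delta)-f_k(\Delta).$$
   Context: A simplicial complex $\Delta$ with (finite) vertex set $V$ is a non-empty collection of subsets of $V$ closed under inclusion and containing all singletons $\{v\}$, $v\in V$. Its elements are called faces; a face $F$ has dimension $|F|-1$ and is called an $i$-face if $|F|=i+1$; $\dim\Delta$ is the maximum dimension of a face. A missing $i$-face of $\Delta$ is a subset $F\subseteq V$ of size $i+1$ that is not a face of $\Delta$ but all of whose proper subsets are faces of $\Delta$. $f_i(\Delta)$ denotes the number of $i$-faces of $\Delta$ (so $f_i(\Delta)=0$ for $i>\dim\Delta$), and $m_i(\Delta)$ denotes the number of missing $i$-faces of $\Delta$. *)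

theory Defs
  imports Complex_Main
begin

definition abstract_simplicial_complex :: "'a set \<Rightarrow> 'a set set \<Rightarrow> bool" where
  "abstract_simplicial_complex V \<Delta> \<longleftrightarrow>
     finite V \<and> \<Delta> \<noteq> {} \<and> (\<forall>F\<in>\<Delta>. F \<subseteq> V) \<and>
     (\<forall>F\<in>\<Delta>. \<forall>G. G \<subseteq> F \<longrightarrow> G \<in> \<Delta>) \<and>
     (\<forall>v\<in>V. {v} \<in> \<Delta>)"

text \<open>Dimensions are integers, since the empty face has dimension \<open>-1\<close>.\<close>

definition face_dim :: "'a set \<Rightarrow> int" where
  "face_dim F = int (card F) - 1"

definition complex_dim :: "'a set set \<Rightarrow> int" where
  "complex_dim \<Delta> = Max (face_dim ` \<Delta>)"

definition faces :: "nat \<Rightarrow> 'a set set \<Rightarrow> 'a set set" where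
  "faces i \<Delta> = {F \<in> \<Delta>. card F = i + 1}"

definition missing_faces :: "nat \<Rightarrow> 'a set \<Rightarrow> 'a set set \<Rightarrow> 'a set set" where
  "missing_faces i V \<Delta> =
     {F. F \<subseteq> V \<and> card F = i + 1 \<and> F \<notin> \<Delta> \<and> (\<forall>G. G \<subset> F \<longrightarrow> G \<in> \<Delta>)}"

definition num_faces :: "nat \<Rightarrow> 'a set set \<Rightarrow> nat" where
  "num_faces i \<Delta> = card (faces i \<Delta>)"

definition num_missing_faces :: "nat \<Rightarrow> 'a set \<Rightarrow> 'a set set \<Rightarrow> nat" where
  "num_missing_faces i V \<Delta> = card (missing_faces i V \<Delta>)"

end

theory Submission
  imports Defs "HOL-Analysis.Convex"
begin

text \<open>
  The \<open>(k+1)\<close>-sets all of whose \<open>k\<close>-subsets lie in the family \<open>A\<close> of \<open>(k-1)\<close>-faces are exactly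
  the \<open>k\<close>-faces and the missing \<open>k\<close>-faces, so the claim is a Moon--Moser type bound for \<open>A\<close>.
  For \<open>F \<in> A\<close> and a vertex \<open>v \<notin> F\<close>, at most \<open>k - 1\<close> of the \<open>k\<close> facets \<open>G\<close> of \<open>F\<close> satisfy
  \<open>G \<union> {v} \<in> A\<close>, unless \<open>F \<union> {v}\<close> is one of these \<open>(k+1)\<close>-sets. Summing over \<open>v\<close> and \<open>F\<close> bounds
  the sum of the squared degrees of the \<open>(k-1)\<close>-sets from above, while Cauchy--Schwarz bounds it
  from below.
\<close>

text \<open>For \<open>k = 2\<close>, with \<open>A\<close> the edges of a graph, these are the
  triangles. An arbitrary family \<open>A\<close> suffices for the counting; a complex enters only
  at the end.\<close>

definition full_sets :: "nat \<Rightarrow> 'a set \<Rightarrow> 'a set set \<Rightarrow> 'a set set" where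
  "full_sets k V A = {S. S \<subseteq> V \<and> card S = Suc k \<and> (\<forall>H\<subseteq>S. card H = k \<longrightarrow> H \<in> A)}"

definition up_degree :: "'a set set \<Rightarrow> 'a set \<Rightarrow> nat" where
  "up_degree A G = card {F \<in> A. G \<subseteq> F}"

lemma finite_full_sets: "finite V \<Longrightarrow> finite (full_sets k V A)"
  unfolding full_sets_def by (rule finite_subset[of _ "Pow V"]) auto

section \<open>Local bounds around a single member of the family\<close>

lemma subset_card_Suc_insert:
  assumes "finite H" "G \<subseteq> H" "card H = Suc (card G)"
  obtains v where "v \<notin> G" "H = insert v G"
proof -
  have "finite G"
    using assms finite_subset by blast
  then have "card (H - G) = 1"
    using assms by (simp add: card_Diff_subset)
  then obtain v where "H - G = {v}"
    by (auto simp: card_1_singleton_iff)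
  with assms(2) show ?thesis
    by (intro that[of v]) auto
qed

text \<open>The \<open>Suc\<close> accounts for \<open>F\<close> itself. Any other member above
  \<open>G\<close> has the form \<open>insert v G\<close> with \<open>v\<close> outside
  \<open>F\<close>, since \<open>v\<close> in \<open>F\<close> would force it to equal
  \<open>F\<close> by cardinality. Counting vertices outside \<open>F\<close> allows the later
  exchange of sums.\<close>

lemma up_degree_le:
  assumes "finite V" "\<And>H. H \<in> A \<Longrightarrow> H \<subseteq> V \<and> card H = Suc j"
    and "F \<in> A" "G \<subseteq> F" "card G = j"
  shows "up_degree A G \<le> Suc (card {v \<in> V - F. insert v G \<in> A})"
proof -
  let ?U = "{v \<in> V - F. insert v G \<in> A}"
  have finF: "finite F" and cF: "card F = Suc j"
    using assms finite_subset by blast+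
  have "{H \<in> A. G \<subseteq> H} \<subseteq> insert F ((\<lambda>v. insert v G) ` ?U)"
  proof
    fix H assume "H \<in> {H \<in> A. G \<subseteq> H}"
    then have H: "H \<in> A" "G \<subseteq> H" by auto
    have "finite H" using H assms(1,2) finite_subset by blast
    then obtain v where v: "v \<notin> G" "H = insert v G"
      using subset_card_Suc_insert[of H G] H assms(2,5) by auto
    show "H \<in> insert F ((\<lambda>v. insert v G) ` ?U)"
    proof (cases "v \<in> F")
      case True
      then have "H \<subseteq> F" using v assms(4) by auto
      then have "H = F" using finF cF assms(2) H card_subset_eq by metis
      then show ?thesis by simp
    next
      case False
      moreover have "v \<in> V" using v H assms(2) by auto
      ultimately show ?thesis using v H by auto
    qed
  qed
  moreover have fin: "finite ?U" using assms(1) by auto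
  ultimately have "up_degree A G \<le> card (insert F ((\<lambda>v. insert v G) ` ?U))"
    unfolding up_degree_def by (intro card_mono) auto
  also have "\<dots> \<le> Suc (card ((\<lambda>v. insert v G) ` ?U))"
    by (rule card_insert_le_m1) auto
  also have "\<dots> \<le> Suc (card ?U)"
    using card_image_le[OF fin] by simp
  finally show ?thesis .
qed

text \<open>\<open>F\<close> has \<open>Suc j\<close> facets. If \<open>v\<close> extends all of
  them into \<open>A\<close>, then, as \<open>F\<close> is in \<open>A\<close> too,
  \<open>insert v F\<close> is full; otherwise at least one facet is lost.\<close>

lemma card_facets_extending_le:
  assumes "finite V" "F \<subseteq> V" "card F = Suc j" "F \<in> A" "v \<in> V - F"
  shows "card {G. G \<subseteq> F \<and> card G = j \<and> insert v G \<in> A}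
          \<le> j + (if insert v F \<in> full_sets (Suc j) V A then 1 else 0)"
proof -
  let ?K = "{G. G \<subseteq> F \<and> card G = j}" and ?E = "{G. G \<subseteq> F \<and> card G = j \<and> insert v G \<in> A}"
  have finF: "finite F" using assms finite_subset by blast
  then have finK: "finite ?K" by simp
  have cK: "card ?K = Suc j"
    using n_subsets[OF finF, of j] assms(3) by simp
  have sub: "?E \<subseteq> ?K" by auto
  show ?thesis
  proof (cases "insert v F \<in> full_sets (Suc j) V A")
    case True
    then show ?thesis using card_mono[OF finK sub] cK by simp
  next
    case False
    moreover have "insert v F \<subseteq> V" "card (insert v F) = Suc (Suc j)"
      using assms finF by auto
    ultimately obtain H where H: "H \<subseteq> insert v F" "card H = Suc j" "H \<notin> A"
      unfolding full_sets_def by auto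
    have "v \<in> H"
    proof (rule ccontr)
      assume "v \<notin> H"
      then have "H \<subseteq> F" using H by auto
      then have "H = F" using H assms(3) finF card_subset_eq by metis
      then show False using H assms by simp
    qed
    \<comment> \<open>Removing \<open>v\<close> from the bad set \<open>H\<close> yields a facet of
      \<open>F\<close> whose extension by \<open>v\<close> is \<open>H\<close>, hence outside
      \<open>A\<close>.\<close>
    then have "H - {v} \<in> ?K - ?E"
      using H by (auto simp: insert_absorb)
    then have "?E \<subset> ?K" using sub by blast
    then have "card ?E < card ?K" by (rule psubset_card_mono[OF finK])
    then have "card ?E \<le> j" unfolding cK by (rule less_Suc_eq_le[THEN iffD1])
    then show ?thesis by (rule trans_le_add1)
  qed
qed

lemma sum_up_degree_facets_le:
  assumes "finite V" "\<And>H. H \<in> A \<Longrightarrow> H \<subseteq> V \<and> card H = Suc j" "F \<in> A"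
  shows "(\<Sum>G | G \<subseteq> F \<and> card G = j. up_degree A G)
          \<le> Suc j + j * (card V - Suc j) + card {S \<in> full_sets (Suc j) V A. F \<subseteq> S}"
proof -
  let ?K = "{G. G \<subseteq> F \<and> card G = j}" and ?T = "full_sets (Suc j) V A"
  have FV: "F \<subseteq> V" and cF: "card F = Suc j" using assms by auto
  have finF: "finite F" using FV assms(1) finite_subset by blast
  then have finK: "finite ?K" by simp
  have cK: "card ?K = Suc j"
    using n_subsets[OF finF, of j] cF by simp
  have "(\<Sum>G\<in>?K. up_degree A G) \<le> (\<Sum>G\<in>?K. Suc (card {v \<in> V - F. insert v G \<in> A}))"
    by (intro sum_mono up_degree_le[OF assms]) auto
  also have "\<dots> = Suc j + (\<Sum>G\<in>?K. card {v \<in> V - F. insert v G \<in> A})"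
    using cK by (simp add: sum_Suc)
  \<comment> \<open>Pairs of a facet \<open>G\<close> and a vertex \<open>v\<close> with
    \<open>insert v G\<close> in \<open>A\<close>, now grouped by \<open>v\<close>.\<close>
  also have "(\<Sum>G\<in>?K. card {v \<in> V - F. insert v G \<in> A})
      = (\<Sum>v\<in>V - F. card {G \<in> ?K. insert v G \<in> A})"
    by (rule sum_multicount_gen) (use assms(1) finK in auto)
  also have "\<dots> \<le> (\<Sum>v\<in>V - F. j + (if insert v F \<in> ?T then 1 else 0))"
    using card_facets_extending_le[OF assms(1) FV cF assms(3)]
    by (intro sum_mono) simp
  also have "\<dots> = j * (card V - Suc j) + card {v \<in> V - F. insert v F \<in> ?T}"
    using assms(1) FV cF finF by (simp add: sum.distrib card_Diff_subset sum.If_cases Int_def)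
  \<comment> \<open>Distinct \<open>v\<close> outside \<open>F\<close> give distinct full sets
    \<open>insert v F\<close> above \<open>F\<close>.\<close>
  also have "card {v \<in> V - F. insert v F \<in> ?T} \<le> card {S \<in> ?T. F \<subseteq> S}"
  proof (rule card_inj_on_le)
    show "inj_on (\<lambda>v. insert v F) {v \<in> V - F. insert v F \<in> ?T}"
      by (auto simp: inj_on_def)
    show "finite {S \<in> ?T. F \<subseteq> S}"
      using finite_full_sets[OF assms(1)] by simp
  qed auto
  finally show ?thesis by simp
qed

section \<open>Global double counting and Cauchy--Schwarz\<close>

lemma sum_up_degree:
  assumes "finite V" "\<And>H. H \<in> A \<Longrightarrow> H \<subseteq> V \<and> card H = Suc j"
  shows "(\<Sum>G | G \<subseteq> V \<and> card G = j. up_degree A G) = Suc j * card A"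
proof -
  let ?K = "{G. G \<subseteq> V \<and> card G = j}"
  have finA: "finite A"
    using assms by (intro finite_subset[of A "Pow V"]) auto
  \<comment> \<open>Incidences \<open>G \<subseteq> F\<close> are counted from the side of
    \<open>F\<close>, which has \<open>Suc j\<close> facets.\<close>
  have "(\<Sum>G\<in>?K. up_degree A G) = (\<Sum>F\<in>A. card {G \<in> ?K. G \<subseteq> F})"
    unfolding up_degree_def by (rule sum_multicount_gen) (use assms(1) finA in auto)
  also have "\<dots> = (\<Sum>F\<in>A. Suc j)"
  proof (rule sum.cong[OF refl])
    fix F assume F: "F \<in> A"
    then have "{G \<in> ?K. G \<subseteq> F} = {G. G \<subseteq> F \<and> card G = j}"
      using assms(2) by blast
    moreover have "finite F" using F assms finite_subset by blast
    ultimately show "card {G \<in> ?K. G \<subseteq> F} = Suc j"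
      using n_subsets[of F j] F assms(2) by simp
  qed
  finally show ?thesis by simp
qed

lemma sum_up_degree_squared_le:
  assumes "finite V" "\<And>H. H \<in> A \<Longrightarrow> H \<subseteq> V \<and> card H = Suc j"
  shows "(\<Sum>G | G \<subseteq> V \<and> card G = j. (up_degree A G)\<^sup>2)
          \<le> (Suc j + j * (card V - Suc j)) * card A + (j + 2) * card (full_sets (Suc j) V A)"
proof -
  let ?K = "{G. G \<subseteq> V \<and> card G = j}" and ?T = "full_sets (Suc j) V A"
  have finA: "finite A"
    using assms by (intro finite_subset[of A "Pow V"]) auto
  \<comment> \<open>A square is the degree added once for each member of \<open>A\<close> above
    \<open>G\<close>; exchanging the sums then leaves, for each \<open>F\<close>, the facet sum
    already bounded.\<close>
  have "(\<Sum>G\<in>?K. (up_degree A G)\<^sup>2) = (\<Sum>G\<in>?K. \<Sum>F | F \<in> A \<and> G \<subseteq> F. up_degree A G)"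
    by (simp add: up_degree_def power2_eq_square)
  also have "\<dots> = (\<Sum>F\<in>A. \<Sum>G | G \<in> ?K \<and> G \<subseteq> F. up_degree A G)"
    by (rule sum.swap_restrict) (use assms(1) finA in auto)
  also have "\<dots> = (\<Sum>F\<in>A. \<Sum>G | G \<subseteq> F \<and> card G = j. up_degree A G)"
  proof (rule sum.cong[OF refl])
    fix F assume "F \<in> A"
    then have "{G. G \<in> ?K \<and> G \<subseteq> F} = {G. G \<subseteq> F \<and> card G = j}"
      using assms(2) by blast
    then show "(\<Sum>G | G \<in> ?K \<and> G \<subseteq> F. up_degree A G) = (\<Sum>G | G \<subseteq> F \<and> card G = j. up_degree A G)"
      by simp
  qed
  also have "\<dots> \<le> (\<Sum>F\<in>A. Suc j + j * (card V - Suc j) + card {S \<in> ?T. F \<subseteq> S})"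
    by (intro sum_mono sum_up_degree_facets_le[OF assms])
  also have "\<dots> = (Suc j + j * (card V - Suc j)) * card A + (\<Sum>F\<in>A. card {S \<in> ?T. F \<subseteq> S})"
    by (subst sum.distrib) (simp only: sum_constant of_nat_id mult.commute)
  also have "(\<Sum>F\<in>A. card {S \<in> ?T. F \<subseteq> S}) = (\<Sum>S\<in>?T. card {F \<in> A. F \<subseteq> S})"
    by (rule sum_multicount_gen) (use finite_full_sets[OF assms(1)] finA in auto)
  \<comment> \<open>A full set has \<open>j + 2\<close> elements, hence \<open>j + 2\<close> subsets
    of size \<open>Suc j\<close>.\<close>
  also have "\<dots> \<le> (\<Sum>S\<in>?T. j + 2)"
  proof (rule sum_mono)
    fix S assume "S \<in> ?T"
    then have S: "finite S" "card S = Suc (Suc j)"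
      using assms(1) finite_subset by (auto simp: full_sets_def)
    have "card {F \<in> A. F \<subseteq> S} \<le> card {F. F \<subseteq> S \<and> card F = Suc j}"
      using assms(2) S by (intro card_mono) auto
    also have "\<dots> = j + 2"
      using n_subsets[OF S(1), of "Suc j"] S(2) by simp
    finally show "card {F \<in> A. F \<subseteq> S} \<le> j + 2" .
  qed
  finally show ?thesis by (simp add: mult.commute)
qed

lemma card_full_sets_ge:
  assumes "finite V" "\<And>H. H \<in> A \<Longrightarrow> H \<subseteq> V \<and> card H = Suc j" "A \<noteq> {}"
  shows "(real (Suc j))\<^sup>2 / real (card V choose j) * (real (card A))\<^sup>2
           - (real (Suc j) + real j * (real (card V) - real (Suc j))) * real (card A)
         \<le> (real j + 2) * real (card (full_sets (Suc j) V A))"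
proof -
  let ?K = "{G. G \<subseteq> V \<and> card G = j}"
  obtain F where "F \<in> A" using assms(3) by blast
  \<comment> \<open>This makes the binomial coefficient positive, so that it can be divided by, and
    turns the truncated difference \<open>card V - Suc j\<close> into the real one.\<close>
  then have le: "Suc j \<le> card V" using assms(2)[of F] card_mono[OF assms(1), of F] by simp
  have cK: "card ?K = card V choose j" using n_subsets assms(1) by blast
  have pos: "0 < real (card V choose j)" using le by simp
  have deg: "(\<Sum>G\<in>?K. up_degree A G) = Suc j * card A"
    by (rule sum_up_degree[OF assms(1)]) (rule assms(2))
  have deg2: "(\<Sum>G\<in>?K. (up_degree A G)\<^sup>2)
      \<le> (Suc j + j * (card V - Suc j)) * card A + (j + 2) * card (full_sets (Suc j) V A)"
    by (rule sum_up_degree_squared_le[OF assms(1)]) (rule assms(2))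
  have "(real (Suc j) * real (card A))\<^sup>2 = (\<Sum>G\<in>?K. real (up_degree A G))\<^sup>2"
    unfolding of_nat_sum[symmetric] deg of_nat_mult ..
  \<comment> \<open>Cauchy--Schwarz over the \<open>card V choose j\<close> sets
    \<open>G\<close>.\<close>
  also have "\<dots> \<le> real (card V choose j) * (\<Sum>G\<in>?K. (real (up_degree A G))\<^sup>2)"
    using sum_squared_le_sum_of_squares[of "\<lambda>G. real (up_degree A G)" ?K] cK
    by (simp add: mult.commute)
  finally have "(real (Suc j))\<^sup>2 / real (card V choose j) * (real (card A))\<^sup>2
      \<le> (\<Sum>G\<in>?K. (real (up_degree A G))\<^sup>2)"
    using pos by (simp add: divide_simps power_mult_distrib mult.commute)
  also have "\<dots> = real (\<Sum>G\<in>?K. (up_degree A G)\<^sup>2)"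
    by simp
  also have "\<dots> \<le> real ((Suc j + j * (card V - Suc j)) * card A
      + (j + 2) * card (full_sets (Suc j) V A))"
    using deg2 by (rule of_nat_mono)
  also have "\<dots> = (real (Suc j) + real j * (real (card V) - real (Suc j))) * real (card A)
      + (real j + 2) * real (card (full_sets (Suc j) V A))"
    using le by (simp only: of_nat_add of_nat_mult of_nat_diff) (simp add: algebra_simps)
  finally show ?thesis by simp
qed

section \<open>Application to simplicial complexes\<close>

text \<open>A proper subset of \<open>S\<close> lies in some \<open>S - {x}\<close>, which has
  \<open>k\<close> elements, so by downward closure it is enough that the \<open>k\<close>-subsets
  are faces. Whether \<open>S\<close> itself is a face decides between the two kinds.\<close>

lemma full_sets_faces:
  assumes "abstract_simplicial_complex V \<Delta>" "k \<ge> 1"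
  shows "full_sets k V (faces (k - 1) \<Delta>) = missing_faces k V \<Delta> \<union> faces k \<Delta>"
proof
  have V: "finite V" and subV: "\<And>F. F \<in> \<Delta> \<Longrightarrow> F \<subseteq> V"
    and down: "\<And>F G. F \<in> \<Delta> \<Longrightarrow> G \<subseteq> F \<Longrightarrow> G \<in> \<Delta>"
    using assms(1) unfolding abstract_simplicial_complex_def by auto
  show "full_sets k V (faces (k - 1) \<Delta>) \<subseteq> missing_faces k V \<Delta> \<union> faces k \<Delta>"
  proof
    fix S assume S: "S \<in> full_sets k V (faces (k - 1) \<Delta>)"
    then have SV: "S \<subseteq> V" and cS: "card S = Suc k"
      and sub: "\<And>H. H \<subseteq> S \<Longrightarrow> card H = k \<Longrightarrow> H \<in> \<Delta>"
      unfolding full_sets_def faces_def by auto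
    have finS: "finite S" using SV V finite_subset by blast
    have "G \<in> \<Delta>" if G: "G \<subset> S" for G
    proof -
      obtain x where x: "x \<in> S" "x \<notin> G" using G by auto
      have "S - {x} \<in> \<Delta>" using sub x finS cS by simp
      then show ?thesis using down x G by blast
    qed
    then show "S \<in> missing_faces k V \<Delta> \<union> faces k \<Delta>"
      using SV cS unfolding missing_faces_def faces_def by auto
  qed
  show "missing_faces k V \<Delta> \<union> faces k \<Delta> \<subseteq> full_sets k V (faces (k - 1) \<Delta>)"
  proof
    fix S assume S: "S \<in> missing_faces k V \<Delta> \<union> faces k \<Delta>"
    then have "S \<subseteq> V" "card S = Suc k"
      using subV unfolding missing_faces_def faces_def by auto
    moreover have "H \<in> \<Delta>" if "H \<subseteq> S" "card H = k" for H
    proof -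
      have "H \<subset> S" using that \<open>card S = Suc k\<close> by auto
      then show ?thesis using S down unfolding missing_faces_def faces_def by blast
    qed
    ultimately show "S \<in> full_sets k V (faces (k - 1) \<Delta>)"
      using assms(2) unfolding full_sets_def faces_def by auto
  qed
qed

theorem theorem5p3:
  fixes V :: "'a set" and \<Delta> :: "'a set set" and k n :: nat
  assumes "k \<ge> 2"
    and "abstract_simplicial_complex V \<Delta>"
    and "complex_dim \<Delta> \<ge> int k - 1"
    and "card V = n"
  shows "real (num_missing_faces k V \<Delta>) \<ge>
      (real k)\<^sup>2 / ((real k + 1) * real (n choose (k - 1))) * (real (num_faces (k - 1) \<Delta>))\<^sup>2
      - (real n * (real k - 1) - real k * (real k - 2)) / (real k + 1) * real (num_faces (k - 1) \<Delta>)
      - real (num_faces k \<Delta>)"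
proof (cases "faces (k - 1) \<Delta> = {}")
  case True
  \<comment> \<open>The terms in \<open>num_faces (k - 1) \<Delta>\<close> vanish, leaving a
    right-hand side that is at most 0.\<close>
  then show ?thesis by (simp add: num_faces_def)
next
  case False
  let ?A = "faces (k - 1) \<Delta>" and ?T = "full_sets k V (faces (k - 1) \<Delta>)"
  obtain j where k: "k = Suc j" using assms(1) by (cases k) auto
  have V: "finite V" and subV: "\<And>F. F \<in> \<Delta> \<Longrightarrow> F \<subseteq> V"
    using assms(2) unfolding abstract_simplicial_complex_def by auto
  have A: "H \<subseteq> V \<and> card H = Suc j" if "H \<in> ?A" for H
    using that subV k unfolding faces_def by auto
  have "?T = missing_faces k V \<Delta> \<union> faces k \<Delta>"
    using full_sets_faces[OF assms(2)] assms(1) by simp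
  then have "card ?T \<le> num_missing_faces k V \<Delta> + num_faces k \<Delta>"
    unfolding num_missing_faces_def num_faces_def using card_Un_le by metis
  then have T: "real (card ?T) \<le> real (num_missing_faces k V \<Delta>) + real (num_faces k \<Delta>)"
    by linarith
  define c where "c = real (n choose (k - 1))"
  define f where "f = real (card ?A)"
  \<comment> \<open>With \<open>k = Suc j\<close> this is \<open>k + (k - 1) * (n - k)\<close>
    expanded over the reals, the linear coefficient of the counting bound; likewise
    \<open>j + 2\<close> becomes \<open>k + 1\<close>.\<close>
  define b where "b = real n * (real k - 1) - real k * (real k - 2)"
  have "(real k)\<^sup>2 / c * f\<^sup>2 - b * f
      \<le> (real k + 1) * real (card ?T)"
    using card_full_sets_ge[OF V A False] assms(4)
    unfolding c_def f_def b_def by (simp add: k algebra_simps)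
  then have "((real k)\<^sup>2 / c * f\<^sup>2 - b * f) / (real k + 1) \<le> real (card ?T)"
    by (simp add: pos_divide_le_eq mult.commute)
  then have "(real k)\<^sup>2 / ((real k + 1) * c) * f\<^sup>2 - b / (real k + 1) * f \<le> real (card ?T)"
    by (simp add: diff_divide_distrib mult.commute)
  with T show ?thesis
    unfolding num_faces_def[of "k - 1"] c_def f_def b_def by linarith
qed

end
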